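(* Let $\mathfrak m$ be an uncountable cardinal with $\sup\{\mathfrak m^{\mathfrak n}:\mathfrak n<\mathfrak m\}=\mathfrak m$. If $G$ is a topological subgroup of $\mathrm{Iso}(\mathbb U_{\mathfrak m})$ of density $<\mathfrak m$ having property (OB), then $G$ is FSIN.
   Context: $\mathbb U_{\mathfrak m}$ is the Urysohn–Katětov space of weight $\mathfrak m$: the complete metric space of density $\mathfrak m$ containing an isometric copy of every metric space of weight $\le\mathfrak m$ and $\mathfrak m$-homogeneous (every isometry between subsets of cardinality $<\mathfrak m$ extends to an isometry of the whole space); $\mathrm{Iso}(\mathbb U_{\mathfrak m})$ is its isometry group with the topology of pointwise convergence. A topological group has property (OB) if every continuous left-invariant pseudometric on it is bounded. A real function $f$ on $G$ is left (resp. right) uniformly continuous if for each $\varepsilon>0$ there is a neighbourhood $V$ of $e$ with $x^{-1}y\in V$ (resp. $xy^{-1}\in V$) implying $|f(x)-f(y)|<\varepsilon$. $G$ is FSIN if the real-valued left uniformly continuous functions on $G$ are exactly the right uniformly continuous ones. *)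

theory Defs
  imports "HOL-Analysis.Analysis"
begin

definition mdense :: "'a set \<Rightarrow> ('a \<Rightarrow> 'a \<Rightarrow> real) \<Rightarrow> 'a set \<Rightarrow> bool" where
  "mdense X d D \<longleftrightarrow> D \<subseteq> X \<and> Metric_space.mtopology X d closure_of D = X"

definition metric_density_eq :: "'a set \<Rightarrow> ('a \<Rightarrow> 'a \<Rightarrow> real) \<Rightarrow> 'k set \<Rightarrow> bool" where
  "metric_density_eq X d M \<longleftrightarrow>
     (\<exists>D. mdense X d D \<and> (card_of D, card_of M) \<in> ordIso) \<and> (\<forall>D. mdense X d D \<longrightarrow> (card_of M, card_of D) \<in> ordLeq)"

text \<open>Weight of a metric space is at most |M| (for metric spaces weight = density).\<close>
definition metric_weight_le :: "'a set \<Rightarrow> ('a \<Rightarrow> 'a \<Rightarrow> real) \<Rightarrow> 'k set \<Rightarrow> bool" where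
  "metric_weight_le X d M \<longleftrightarrow> (\<exists>D. mdense X d D \<and> (card_of D, card_of M) \<in> ordLeq)"

definition isometric_map ::
  "'b set \<Rightarrow> ('b \<Rightarrow> 'b \<Rightarrow> real) \<Rightarrow> 'a set \<Rightarrow> ('a \<Rightarrow> 'a \<Rightarrow> real) \<Rightarrow> ('b \<Rightarrow> 'a) \<Rightarrow> bool" where
  "isometric_map X e U d f \<longleftrightarrow> f ` X \<subseteq> U \<and> (\<forall>x\<in>X. \<forall>y\<in>X. d (f x) (f y) = e x y)"

definition urysohn_katetov :: "'a set \<Rightarrow> ('a \<Rightarrow> 'a \<Rightarrow> real) \<Rightarrow> 'k set \<Rightarrow> bool" where
  "urysohn_katetov U d M \<longleftrightarrow>
     Metric_space U d \<and> Metric_space.mcomplete U d \<and> metric_density_eq U d M \<and>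
     (\<forall>(X::'k set) e. Metric_space X e \<and> metric_weight_le X e M \<longrightarrow>
        (\<exists>f. isometric_map X e U d f)) \<and>
     (\<forall>A B h. A \<subseteq> U \<and> B \<subseteq> U \<and> (card_of A, card_of M) \<in> ordLess \<and> bij_betw h A B \<and> isometric_map A d U d h
        \<longrightarrow> (\<exists>g. bij_betw g U U \<and> isometric_map U d U d g \<and> (\<forall>x\<in>A. g x = h x)))"

definition Iso :: "'a set \<Rightarrow> ('a \<Rightarrow> 'a \<Rightarrow> real) \<Rightarrow> ('a \<Rightarrow> 'a) set" where
  "Iso U d = {g. g \<in> extensional U \<and> bij_betw g U U \<and> isometric_map U d U d g}"

definition Iso_topology :: "'a set \<Rightarrow> ('a \<Rightarrow> 'a \<Rightarrow> real) \<Rightarrow> ('a \<Rightarrow> 'a) topology" where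
  "Iso_topology U d = subtopology (product_topology (\<lambda>_. Metric_space.mtopology U d) U) (Iso U d)"

definition iso_mult :: "'a set \<Rightarrow> ('a \<Rightarrow> 'a) \<Rightarrow> ('a \<Rightarrow> 'a) \<Rightarrow> ('a \<Rightarrow> 'a)" where
  "iso_mult U g h = compose U g h"

definition iso_inv :: "'a set \<Rightarrow> ('a \<Rightarrow> 'a) \<Rightarrow> ('a \<Rightarrow> 'a)" where
  "iso_inv U g = restrict (inv_into U g) U"

definition iso_one :: "'a set \<Rightarrow> ('a \<Rightarrow> 'a)" where
  "iso_one U = restrict id U"

definition iso_subgroup :: "'a set \<Rightarrow> ('a \<Rightarrow> 'a \<Rightarrow> real) \<Rightarrow> ('a \<Rightarrow> 'a) set \<Rightarrow> bool" where
  "iso_subgroup U d G \<longleftrightarrow> G \<subseteq> Iso U d \<and> iso_one U \<in> G \<and>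
     (\<forall>g\<in>G. \<forall>h\<in>G. iso_mult U g h \<in> G) \<and> (\<forall>g\<in>G. iso_inv U g \<in> G)"

definition G_topology :: "'a set \<Rightarrow> ('a \<Rightarrow> 'a \<Rightarrow> real) \<Rightarrow> ('a \<Rightarrow> 'a) set \<Rightarrow> ('a \<Rightarrow> 'a) topology" where
  "G_topology U d G = subtopology (Iso_topology U d) G"

definition density_less :: "'b topology \<Rightarrow> 'k set \<Rightarrow> bool" where
  "density_less T M \<longleftrightarrow> (\<exists>D. D \<subseteq> topspace T \<and> T closure_of D = topspace T \<and> (card_of D, card_of M) \<in> ordLess)"

definition property_OB :: "'a set \<Rightarrow> ('a \<Rightarrow> 'a \<Rightarrow> real) \<Rightarrow> ('a \<Rightarrow> 'a) set \<Rightarrow> bool" where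
  "property_OB U d G \<longleftrightarrow>
     (\<forall>p :: ('a \<Rightarrow> 'a) \<Rightarrow> ('a \<Rightarrow> 'a) \<Rightarrow> real.
        ((\<forall>x\<in>G. p x x = 0) \<and> (\<forall>x\<in>G. \<forall>y\<in>G. p x y = p y x) \<and>
         (\<forall>x\<in>G. \<forall>y\<in>G. \<forall>z\<in>G. p x z \<le> p x y + p y z) \<and>
         continuous_map (prod_topology (G_topology U d G) (G_topology U d G)) euclideanreal
           (\<lambda>(x, y). p x y) \<and>
         (\<forall>g\<in>G. \<forall>x\<in>G. \<forall>y\<in>G. p (iso_mult U g x) (iso_mult U g y) = p x y))
        \<longrightarrow> (\<exists>B. \<forall>x\<in>G. \<forall>y\<in>G. p x y \<le> B))"

definition left_unif_cont :: "'a set \<Rightarrow> ('a \<Rightarrow> 'a \<Rightarrow> real) \<Rightarrow> ('a \<Rightarrow> 'a) set \<Rightarrow> (('a \<Rightarrow> 'a) \<Rightarrow> real) \<Rightarrow> bool" where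
  "left_unif_cont U d G f \<longleftrightarrow>
     (\<forall>\<epsilon>>0. \<exists>V. openin (G_topology U d G) V \<and> iso_one U \<in> V \<and>
        (\<forall>x\<in>G. \<forall>y\<in>G. iso_mult U (iso_inv U x) y \<in> V \<longrightarrow> \<bar>f x - f y\<bar> < \<epsilon>))"

definition right_unif_cont :: "'a set \<Rightarrow> ('a \<Rightarrow> 'a \<Rightarrow> real) \<Rightarrow> ('a \<Rightarrow> 'a) set \<Rightarrow> (('a \<Rightarrow> 'a) \<Rightarrow> real) \<Rightarrow> bool" where
  "right_unif_cont U d G f \<longleftrightarrow>
     (\<forall>\<epsilon>>0. \<exists>V. openin (G_topology U d G) V \<and> iso_one U \<in> V \<and>
        (\<forall>x\<in>G. \<forall>y\<in>G. iso_mult U x (iso_inv U y) \<in> V \<longrightarrow> \<bar>f x - f y\<bar> < \<epsilon>))"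

definition FSIN :: "'a set \<Rightarrow> ('a \<Rightarrow> 'a \<Rightarrow> real) \<Rightarrow> ('a \<Rightarrow> 'a) set \<Rightarrow> bool" where
  "FSIN U d G \<longleftrightarrow> (\<forall>f. left_unif_cont U d G f \<longleftrightarrow> right_unif_cont U d G f)"

end

theory Submission
  imports Defs
begin

text \<open>
  By homogeneity, every Katetov function on fewer than \<open>|M|\<close> points of \<open>U\<close> is realised as the
  distance to a point of \<open>U\<close>; by the density assumption on \<open>G\<close>, this extends to Katetov functions
  on a union of countably many orbits, and by (OB) such orbits are bounded. If a point \<open>w\<close> has
  distance function \<open>\<phi>\<close> on \<open>G x\<close> and \<open>d (v w) w < \<eta>\<close>, then \<open>v\<close> changes \<open>\<phi>\<close> by less than
  \<open>\<eta>\<close> on the whole orbit, so the basic neighbourhood of the identity given by \<open>w\<close> acts uniformly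
  from the left. Left uniformly continuous functions need not be bounded, so they cannot be
  realised as distance functions themselves. Instead the truncated distance to the \<open>n\<epsilon>\<close>-sublevel set of \<open>f\<close>
  is realised by points \<open>z n\<close>, and the distance to the set of the \<open>z n\<close> by further points. An
  isometry almost fixing the latter permutes the well-ordered chain of sublevel sets approximately,
  hence changes \<open>f\<close> uniformly little. The converse inclusion follows by inversion.
\<close>

unbundle cardinal_syntax

section \<open>Cardinals below an uncountable one\<close>

lemma countable_ordLess_uncountable:
  assumes "countable B" and "uncountable M"
  shows "|B| <o |M|"
proof (rule ccontr)
  assume "\<not> ?thesis"
  then have "|M| \<le>o |B|"
    using not_ordLess_iff_ordLeq[OF card_of_Well_order card_of_Well_order] by blast
  then obtain j where "inj_on j M" "j ` M \<subseteq> B"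
    using card_of_ordLeq[of M B] by blast
  then have "countable M"
    using assms(1) countable_subset countable_image_inj_on by blast
  with assms(2) show False by blast
qed

text \<open>A countable product lies below \<open>M\<close>; otherwise \<open>A\<close> is infinite,
  at least as large as \<open>B\<close>, and absorbs it. This bounds the number of translates of a
  countable set by a dense subset of the group.\<close>

lemma Times_countable_ordLess:
  assumes "|A| <o |M|" and "countable B" and "uncountable M"
  shows "|A \<times> B| <o |M|"
proof (cases "countable A")
  case True
  then show ?thesis
    using assms by (intro countable_ordLess_uncountable countable_SIGMA) auto
next
  case False
  have "|B| \<le>o |A|"
    using countable_ordLess_uncountable[OF assms(2) False] ordLess_imp_ordLeq by blast
  moreover have "infinite A"
    using False countable_finite by blast
  ultimately have "|A \<times> B| \<le>o |A|"
    using card_of_Times_infinite[of A B] ordIso_imp_ordLeq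
    by (cases "B = {}") (auto simp: card_of_empty)
  then show ?thesis
    using assms(1) ordLeq_ordLess_trans by blast
qed

section \<open>One-point extensions in the Urysohn-Katetov space\<close>

locale urysohn_subgroup = Metric_space U d
  for U :: "'a set" and d :: "'a \<Rightarrow> 'a \<Rightarrow> real" +
  fixes M :: "'k set" and G :: "('a \<Rightarrow> 'a) set"
  assumes uncountable: "uncountable M"
    and UK: "urysohn_katetov U d M"
    and subgroup: "iso_subgroup U d G"
    and dens: "density_less (G_topology U d G) M"
    and OB: "property_OB U d G"
begin

lemma isometry_extension:
  assumes "A \<subseteq> U" "B \<subseteq> U" "|A| <o |M|" "bij_betw h A B" "isometric_map A d U d h"
  obtains g where "g ` U = U" "\<And>x y. x \<in> U \<Longrightarrow> y \<in> U \<Longrightarrow> d (g x) (g y) = d x y"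
    "\<And>x. x \<in> A \<Longrightarrow> g x = h x"
proof -
  obtain g where g: "bij_betw g U U" "isometric_map U d U d g" "\<forall>x\<in>A. g x = h x"
    using UK assms unfolding urysohn_katetov_def by blast
  show thesis
    by (rule that[of g]) (use g in \<open>simp_all add: isometric_map_def bij_betw_def\<close>)
qed

text \<open>The whole carrier is dense in itself, so inside \<open>M\<close> its size already bounds
  the weight and universality applies.\<close>

lemma isometric_embedding:
  fixes X :: "'k set"
  assumes "Metric_space X e" "X \<subseteq> M"
  obtains f where "f ` X \<subseteq> U" "\<And>x y. x \<in> X \<Longrightarrow> y \<in> X \<Longrightarrow> d (f x) (f y) = e x y"
proof -
  have "Metric_space.mtopology X e closure_of X = X"
    using closure_of_topspace[of "Metric_space.mtopology X e"] 
    by (simp add: Metric_space.topspace_mtopology[OF assms(1)])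
  then have "metric_weight_le X e M"
    using assms(2) card_of_mono1 unfolding metric_weight_le_def mdense_def by blast
  then have "\<exists>f. isometric_map X e U d f"
    using UK assms(1) unfolding urysohn_katetov_def by blast
  then show thesis
    using that unfolding isometric_map_def by blast
qed

text \<open>The abstract space consisting of \<open>A\<close> and one new point is copied into
  \<open>M\<close> and embedded in \<open>U\<close> by universality; homogeneity then moves the
  embedded copy of \<open>A\<close> back onto \<open>A\<close>, carrying the new point to
  \<open>z\<close>.\<close>

lemma one_point_extension:
  assumes A: "A \<subseteq> U" "|A| <o |M|"
    and pos: "\<And>a. a \<in> A \<Longrightarrow> \<phi> a > 0"
    and lip: "\<And>a b. a \<in> A \<Longrightarrow> b \<in> A \<Longrightarrow> \<phi> a \<le> \<phi> b + d a b"
    and tri: "\<And>a b. a \<in> A \<Longrightarrow> b \<in> A \<Longrightarrow> d a b \<le> \<phi> a + \<phi> b"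
  obtains z where "z \<in> U" "\<And>a. a \<in> A \<Longrightarrow> d z a = \<phi> a"
proof -
  obtain i where i: "inj_on i A" "i ` A \<subseteq> M"
    using card_of_ordLeq[of A M] ordLess_imp_ordLeq[OF A(2)] by blast
  \<comment> \<open>Strict inequality of cardinals leaves room in \<open>M\<close> for the new point
    \<open>k\<close>.\<close>
  have "i ` A \<noteq> M"
  proof
    assume "i ` A = M"
    then have "|M| \<le>o |A|"
      using card_of_image[of i A] by simp
    with A(2) show False
      using not_ordLess_ordLeq by blast
  qed
  then obtain k where k: "k \<in> M" "k \<notin> i ` A"
    using i(2) by blast
  define j where "j = inv_into A i"
  have j: "j (i a) = a" if "a \<in> A" for a
    using that i(1) by (simp add: j_def)
  have ik: "i a \<noteq> k" if "a \<in> A" for a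
    using that k(2) by blast
  \<comment> \<open>\<open>Metric_space\<close> demands nonnegativity for all arguments, also
    outside the carrier; the absolute value provides it and changes nothing on
    \<open>A\<close>.\<close>
  define e where "e = (\<lambda>x y. if x = k then (if y = k then 0 else \<bar>\<phi> (j y)\<bar>)
                             else if y = k then \<bar>\<phi> (j x)\<bar> else d (j x) (j y))"
  have AU: "a \<in> U" if "a \<in> A" for a
    using that A(1) by blast
  define X where "X = insert k (i ` A)"
  have e: "e k k = 0" "\<And>a. a \<in> A \<Longrightarrow> e k (i a) = \<phi> a" "\<And>a. a \<in> A \<Longrightarrow> e (i a) k = \<phi> a"
    "\<And>a b. a \<in> A \<Longrightarrow> b \<in> A \<Longrightarrow> e (i a) (i b) = d a b"
    by (simp_all add: e_def ik j abs_of_pos pos)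
  have X: "x = k \<or> (\<exists>a\<in>A. x = i a)" if "x \<in> X" for x
    using that unfolding X_def by blast
  have "Metric_space X e"
  proof
    show "0 \<le> e x y" for x y
      by (simp add: e_def)
    show "e x y = e y x" for x y
      by (simp add: e_def commute)
    show "e x y = 0 \<longleftrightarrow> x = y" if "x \<in> X" "y \<in> X" for x y
    proof -
      have "\<phi> a \<noteq> 0" "i a \<noteq> k" "k \<noteq> i a" if "a \<in> A" for a
        using pos[OF that] ik[OF that] by auto
      moreover have "d a b = 0 \<longleftrightarrow> i a = i b" if "a \<in> A" "b \<in> A" for a b
        using that by (simp add: AU inj_on_eq_iff[OF i(1)])
      ultimately show ?thesis
        using X[OF \<open>x \<in> X\<close>] X[OF \<open>y \<in> X\<close>] by (elim disjE bexE) (simp_all only: e simp_thms)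
    qed
    show "e x z \<le> e x y + e y z" if "x \<in> X" "y \<in> X" "z \<in> X" for x y z
    proof -
      have "d a b \<le> \<phi> a + \<phi> b" "\<phi> a \<le> \<phi> b + d a b" "\<phi> a \<le> d a b + \<phi> b" "\<phi> b \<le> \<phi> a + d a b"
        if "a \<in> A" "b \<in> A" for a b
        using tri lip[OF that] lip[OF that(2,1)] that by (simp_all add: commute)
      moreover have "d a c \<le> d a b + d b c" if "a \<in> A" "b \<in> A" "c \<in> A" for a b c
        using that by (simp add: triangle AU)
      moreover have "0 \<le> \<phi> a + \<phi> a" "0 \<le> \<phi> a" if "a \<in> A" for a
        using pos[OF that] by simp_all
      ultimately show ?thesis
        using X[OF \<open>x \<in> X\<close>] X[OF \<open>y \<in> X\<close>] X[OF \<open>z \<in> X\<close>]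
        by (elim disjE bexE) (simp_all only: e add_0_left add_0_right order_refl)
    qed
  qed
  moreover have "X \<subseteq> M"
    using i(2) k(1) by (simp add: X_def)
  ultimately obtain f where f: "f ` X \<subseteq> U" "\<And>x y. x \<in> X \<Longrightarrow> y \<in> X \<Longrightarrow> d (f x) (f y) = e x y"
    by (rule isometric_embedding) blast
  define h where "h = f \<circ> i"
  have hU: "h a \<in> U" if "a \<in> A" for a
    using that f(1) by (auto simp: h_def X_def)
  have fkU: "f k \<in> U"
    using f(1) by (simp add: X_def)
  have hd: "d (h a) (h b) = d a b" if "a \<in> A" "b \<in> A" for a b
    using that by (simp add: h_def f(2) X_def e_def ik j)
  have hk: "d (f k) (h a) = \<phi> a" if "a \<in> A" for a
    using that pos[OF that] by (simp add: h_def f(2) X_def e_def ik j)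
  have inj: "inj_on h A"
    using hd AU hU by (metis inj_onI zero)
  \<comment> \<open>The isometry that homogeneity extends: from the embedded copy of
    \<open>A\<close> back to \<open>A\<close>.\<close>
  define h' where "h' = inv_into A h"
  have h': "h' (h a) = a" if "a \<in> A" for a
    using that inj by (simp add: h'_def)
  have "|h ` A| <o |M|"
    using card_of_image A(2) ordLeq_ordLess_trans by blast
  moreover have "bij_betw h' (h ` A) A"
    using inj by (simp add: h'_def bij_betw_inv_into inj_on_imp_bij_betw)
  moreover have "isometric_map (h ` A) d U d h'"
    using hd AU by (auto simp: isometric_map_def h')
  moreover have "h ` A \<subseteq> U"
    using hU by blast
  ultimately obtain g where g: "g ` U = U" "\<And>x y. x \<in> U \<Longrightarrow> y \<in> U \<Longrightarrow> d (g x) (g y) = d x y"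
    "\<And>x. x \<in> h ` A \<Longrightarrow> g x = h' x"
    using A(1) isometry_extension[of "h ` A" A h'] by metis
  show thesis
  proof
    show "g (f k) \<in> U"
      using g(1) fkU by blast
    show "d (g (f k)) a = \<phi> a" if "a \<in> A" for a
      using g(2)[OF fkU hU[OF that]] g(3)[of "h a"] h'[OF that] hk[OF that] that by simp
  qed
qed

section \<open>The group action and its pointwise topology\<close>

lemma G_Iso: "G \<subseteq> Iso U d"
  and one_in_G [simp]: "iso_one U \<in> G"
  and mult_in_G [simp]: "g \<in> G \<Longrightarrow> h \<in> G \<Longrightarrow> iso_mult U g h \<in> G"
  and inv_in_G [simp]: "g \<in> G \<Longrightarrow> iso_inv U g \<in> G"
  using subgroup by (auto simp: iso_subgroup_def)

lemma G_bij: "g \<in> G \<Longrightarrow> bij_betw g U U"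
  and G_ext: "g \<in> G \<Longrightarrow> g \<in> extensional U"
  and G_dist [simp]: "g \<in> G \<Longrightarrow> x \<in> U \<Longrightarrow> y \<in> U \<Longrightarrow> d (g x) (g y) = d x y"
  using G_Iso by (auto simp: Iso_def isometric_map_def)

lemma G_closed [simp]: "g \<in> G \<Longrightarrow> x \<in> U \<Longrightarrow> g x \<in> U"
  using G_bij bij_betwE by blast

lemma one_apply [simp]: "x \<in> U \<Longrightarrow> iso_one U x = x"
  by (simp add: iso_one_def)

lemma mult_apply [simp]: "x \<in> U \<Longrightarrow> iso_mult U g h x = g (h x)"
  by (simp add: iso_mult_def compose_eq)

lemma inv_apply [simp]:
  assumes "g \<in> G" "x \<in> U"
  shows "iso_inv U g (g x) = x" "g (iso_inv U g x) = x"
  using assms G_bij[of g] bij_betw_inv_into_left[of g U U x] bij_betw_inv_into_right[of g U U x]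
  by (auto simp: iso_inv_def)

lemma G_eqI: "g \<in> G \<Longrightarrow> h \<in> G \<Longrightarrow> (\<And>x. x \<in> U \<Longrightarrow> g x = h x) \<Longrightarrow> g = h"
  using G_ext extensionalityI by blast

lemma dist_inv_left: "g \<in> G \<Longrightarrow> x \<in> U \<Longrightarrow> y \<in> U \<Longrightarrow> d (iso_inv U g x) y = d x (g y)"
  using G_dist[of g "iso_inv U g x" y] by simp

lemma topspace_G [simp]: "topspace (G_topology U d G) = G"
proof -
  have "G \<subseteq> (\<Pi>\<^sub>E x\<in>U. U)"
    using G_ext by (auto simp: PiE_def)
  then show ?thesis
    using G_Iso by (auto simp: G_topology_def Iso_topology_def)
qed

lemma continuous_map_eval: "x \<in> U \<Longrightarrow> continuous_map (G_topology U d G) mtopology (\<lambda>g. g x)"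
  unfolding G_topology_def Iso_topology_def
  by (intro continuous_map_from_subtopology continuous_map_product_projection)

lemma continuous_map_dist:
  assumes "continuous_map X mtopology f" "continuous_map X mtopology g"
  shows "continuous_map X euclideanreal (\<lambda>x. d (f x) (g x))"
  using continuous_map_mdist[of X "metric (U, d)" f g] assms by simp

lemma openin_displacement:
  assumes "x \<in> U"
  shows "openin (G_topology U d G) {g \<in> G. d (g x) x < \<eta>}"
proof -
  have "continuous_map (G_topology U d G) euclideanreal (\<lambda>g. d (g x) x)"
    using assms by (intro continuous_map_dist continuous_map_eval) auto
  from openin_continuous_map_preimage[OF this, of "{..<\<eta>}"] show ?thesis
    by simp
qed

text \<open>A basic open set of the product restricts only finitely many coordinates, and the least
  of the corresponding radii serves for all of them.\<close>

lemma nhd_one_contains_displacement: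
  assumes "openin (G_topology U d G) V" "iso_one U \<in> V"
  obtains F \<delta> where "finite F" "F \<subseteq> U" "\<delta> > 0"
    "\<And>g. g \<in> G \<Longrightarrow> (\<And>x. x \<in> F \<Longrightarrow> d (g x) x < \<delta>) \<Longrightarrow> g \<in> V"
proof -
  obtain W where W: "openin (product_topology (\<lambda>_. mtopology) U) W" "V = W \<inter> Iso U d \<inter> G"
    using assms(1) by (auto simp: G_topology_def Iso_topology_def openin_subtopology)
  then obtain P where P: "finite {x \<in> U. P x \<noteq> U}" "\<And>x. x \<in> U \<Longrightarrow> openin mtopology (P x)"
     "iso_one U \<in> Pi\<^sub>E U P" "Pi\<^sub>E U P \<subseteq> W"
    using assms(2) by (auto simp: openin_product_topology_alt)
  define F where "F = {x \<in> U. P x \<noteq> U}"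
  have "\<exists>r>0. mball x r \<subseteq> P x" if "x \<in> U" for x
    using P(2)[OF that] PiE_mem[OF P(3) that] that by (simp add: openin_mtopology)
  then obtain r where r: "\<And>x. x \<in> U \<Longrightarrow> r x > 0 \<and> mball x (r x) \<subseteq> P x"
    by metis
  \<comment> \<open>The element 1 keeps \<open>Min\<close> meaningful when \<open>F\<close> is
    empty.\<close>
  define \<delta> where "\<delta> = Min (insert 1 (r ` F))"
  have F: "finite F" "F \<subseteq> U"
    using P(1) by (auto simp: F_def)
  show thesis
  proof
    show "finite F" "F \<subseteq> U"
      by (fact F)+
    show "\<delta> > 0"
      using F r by (auto simp: \<delta>_def)
    show "g \<in> V" if g: "g \<in> G" "\<And>x. x \<in> F \<Longrightarrow> d (g x) x < \<delta>" for g
    proof -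
      have "g x \<in> P x" if "x \<in> U" for x
      proof (cases "x \<in> F")
        case True
        then have "\<delta> \<le> r x"
          using F by (simp add: \<delta>_def)
        then have "g x \<in> mball x (r x)"
          using g(2)[OF True] g(1) that by (simp add: commute)
        then show ?thesis
          using r[OF that] by blast
      next
        case False
        then show ?thesis
          using that g(1) by (simp add: F_def)
      qed
      then have "g \<in> W"
        using P(4) G_ext[OF g(1)] by (auto simp: PiE_def)
      then show ?thesis
        using W(2) g(1) G_Iso by blast
    qed
  qed
qed

section \<open>Bounded orbits and small dense sets of group elements\<close>

text \<open>The pseudometric comparing \<open>g x\<close> with \<open>h x\<close> is continuous, and
  left-invariant because \<open>G\<close> acts by isometries, so (OB) bounds it.\<close>

lemma orbit_bounded:
  assumes "x \<in> U"
  obtains R where "\<And>g h. g \<in> G \<Longrightarrow> h \<in> G \<Longrightarrow> d (g x) (h x) \<le> R"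
proof -
  define p where "p = (\<lambda>g h :: 'a \<Rightarrow> 'a. d (g x) (h x))"
  have "continuous_map (prod_topology (G_topology U d G) (G_topology U d G)) euclideanreal (\<lambda>(g, h). p g h)"
    unfolding p_def case_prod_beta
    using continuous_map_compose[OF continuous_map_fst continuous_map_eval[OF assms]]
      continuous_map_compose[OF continuous_map_snd continuous_map_eval[OF assms]]
    by (intro continuous_map_dist) (simp_all add: o_def)
  then have "\<exists>B. \<forall>g\<in>G. \<forall>h\<in>G. p g h \<le> B"
    using assms OB[unfolded property_OB_def, rule_format, of p]
    by (simp add: p_def commute triangle)
  then show thesis
    using that by (auto simp: p_def)
qed

lemma orbits_bounded:
  assumes "x \<in> U" "B \<subseteq> U" "\<And>b. b \<in> B \<Longrightarrow> d b x \<le> r"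
  obtains R where "R > 0" "\<And>g h b c. \<lbrakk>g \<in> G; h \<in> G; b \<in> B; c \<in> B\<rbrakk> \<Longrightarrow> d (g b) (h c) \<le> R"
proof -
  obtain R where R: "\<And>g h. g \<in> G \<Longrightarrow> h \<in> G \<Longrightarrow> d (g x) (h x) \<le> R"
    using orbit_bounded assms(1) by blast
  have *: "d (g b) (h c) \<le> r + R + r" if "g \<in> G" "h \<in> G" "b \<in> B" "c \<in> B" for g h b c
  proof -
    have U: "b \<in> U" "c \<in> U"
      using that assms(2) by auto
    have "d (g b) (h c) \<le> d (g b) (g x) + d (g x) (h x) + d (h x) (h c)"
      using triangle[of "g b" "g x" "h c"] triangle[of "g x" "h x" "h c"] U that assms(1) by simp
    also have "\<dots> = d b x + d (g x) (h x) + d c x"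
      using U that assms(1) by (simp add: commute)
    also have "\<dots> \<le> r + R + r"
      using R that assms(3) by (intro add_mono) auto
    finally show ?thesis .
  qed
  \<comment> \<open>The maximum with 1 makes the bound positive, so that it can serve as an offset
    in strictly positive Katetov functions.\<close>
  show thesis
    by (rule that[of "max 1 (r + R + r)"]) (use * in \<open>force+\<close>)
qed

lemma dense_subset:
  obtains D where "D \<subseteq> G" "|D| <o |M|"
    "\<And>g x \<epsilon>. g \<in> G \<Longrightarrow> x \<in> U \<Longrightarrow> \<epsilon> > 0 \<Longrightarrow> \<exists>h\<in>D. d (g x) (h x) < \<epsilon>"
proof -
  obtain D where D: "D \<subseteq> G" "G_topology U d G closure_of D = G" "|D| <o |M|"
    using dens by (auto simp: density_less_def)
  have "\<exists>h\<in>D. d (g x) (h x) < \<epsilon>" if "g \<in> G" "x \<in> U" "\<epsilon> > 0" for g x \<epsilon>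
  proof -
    have "continuous_map (G_topology U d G) euclideanreal (\<lambda>h. d (g x) (h x))"
      using that by (intro continuous_map_dist continuous_map_eval) auto
    from openin_continuous_map_preimage[OF this, of "{..<\<epsilon>}"]
    have T: "openin (G_topology U d G) {h \<in> G. d (g x) (h x) < \<epsilon>}"
      by simp
    have "g \<in> G_topology U d G closure_of D"
      using D(2) that(1) by simp
    then have "\<exists>h. h \<in> D \<and> h \<in> {h \<in> G. d (g x) (h x) < \<epsilon>}"
      unfolding in_closure_of
      by (elim conjE, elim allE[of _ "{h \<in> G. d (g x) (h x) < \<epsilon>}"] impE) (use T that in simp_all)
    then show ?thesis
      by auto
  qed
  with D that show thesis by blast
qed

section \<open>Realising Katetov functions on orbits\<close>

text \<open>The function is first realised on the translates of \<open>B\<close> by a small dense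
  set \<open>D\<close>. These are dense in the orbits, and both \<open>d z\<close> and
  \<open>\<phi>\<close> are 1-Lipschitz, so their equality passes to the orbits.\<close>

lemma orbit_extension:
  assumes B: "B \<subseteq> U" "countable B"
    and pos: "\<And>y. y \<in> U \<Longrightarrow> \<phi> y > 0"
    and lip: "\<And>x y. x \<in> U \<Longrightarrow> y \<in> U \<Longrightarrow> \<phi> x \<le> \<phi> y + d x y"
    and tri: "\<And>g h b c. \<lbrakk>g \<in> G; h \<in> G; b \<in> B; c \<in> B\<rbrakk> \<Longrightarrow> d (g b) (h c) \<le> \<phi> (g b) + \<phi> (h c)"
  obtains z where "z \<in> U" "\<And>g b. g \<in> G \<Longrightarrow> b \<in> B \<Longrightarrow> d z (g b) = \<phi> (g b)"
proof -
  obtain D where D: "D \<subseteq> G" "|D| <o |M|"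
    "\<And>g x \<epsilon>. g \<in> G \<Longrightarrow> x \<in> U \<Longrightarrow> \<epsilon> > 0 \<Longrightarrow> \<exists>h\<in>D. d (g x) (h x) < \<epsilon>"
    using dense_subset by blast
  define Y where "Y = (\<lambda>(g, b). g b) ` (D \<times> B)"
  have Y: "h b \<in> Y" if "h \<in> D" "b \<in> B" for h b
    using that unfolding Y_def by force
  have "Y \<subseteq> U"
    using D(1) B(1) G_closed unfolding Y_def by fastforce
  moreover have "|Y| <o |M|"
    using Times_countable_ordLess[OF D(2) B(2) uncountable] card_of_image ordLeq_ordLess_trans
    unfolding Y_def by blast
  moreover have "d x y \<le> \<phi> x + \<phi> y" if "x \<in> Y" "y \<in> Y" for x y
    using that tri subsetD[OF D(1)] unfolding Y_def by auto
  ultimately obtain z where z: "z \<in> U" "\<And>y. y \<in> Y \<Longrightarrow> d z y = \<phi> y"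
    using one_point_extension[of Y \<phi>] pos lip by (metis subsetD)
  have "d z (g b) = \<phi> (g b)" if gb: "g \<in> G" "b \<in> B" for g b
  proof -
    have b: "b \<in> U"
      using gb B by blast
    \<comment> \<open>Replacing \<open>g b\<close> by a point within \<open>\<epsilon> / 2\<close>
      costs at most \<open>\<epsilon> / 2\<close> for each of the two functions.\<close>
    have "\<bar>d z (g b) - \<phi> (g b)\<bar> \<le> 0 + \<epsilon>" if "\<epsilon> > 0" for \<epsilon>
    proof -
      obtain h where h: "h \<in> D" "d (g b) (h b) < \<epsilon> / 2"
        using D(3)[OF gb(1) b half_gt_zero[OF \<open>\<epsilon> > 0\<close>]] by blast
      have hb: "h b \<in> U" "g b \<in> U" "d z (h b) = \<phi> (h b)"
        using h(1) D(1) b gb z(2)[OF Y] by auto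
      show ?thesis
        using lip[OF hb(1,2)] lip[OF hb(2,1)] triangle[OF z(1) hb(1,2)] triangle[OF z(1) hb(2,1)]
          commute[of "g b" "h b"] h(2) hb(3) by linarith
    qed
    then show ?thesis
      using field_le_epsilon[of "\<bar>d z (g b) - \<phi> (g b)\<bar>" 0] by simp
  qed
  with z(1) that show thesis by blast
qed

text \<open>The point realises \<open>y \<mapsto> C + min \<eta> (dist y S)\<close> on the orbits of \<open>B\<close>; the
  constant \<open>C\<close> does not depend on \<open>S\<close>.\<close>
lemma realise_distance_to_set:
  assumes x: "x \<in> U" and B: "B \<subseteq> U" "countable B" "\<And>b. b \<in> B \<Longrightarrow> d b x \<le> r"
    and \<eta>: "\<eta> > 0"
  obtains C where "\<And>S. S \<subseteq> U \<Longrightarrow> S \<noteq> {} \<Longrightarrow> \<exists>z\<in>U. \<forall>g\<in>G. \<forall>b\<in>B.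
    d z (g b) \<le> C + \<eta> \<and> (g b \<in> S \<longrightarrow> d z (g b) = C) \<and>
    (d z (g b) < C + \<eta> \<longrightarrow> (\<exists>s\<in>S. d (g b) s < \<eta>))"
proof -
  obtain C where C: "C > 0" "\<And>g h b c. \<lbrakk>g \<in> G; h \<in> G; b \<in> B; c \<in> B\<rbrakk> \<Longrightarrow> d (g b) (h c) \<le> C"
    using orbits_bounded[OF x B(1,3)] by blast
  show thesis
  proof
    fix S assume S: "S \<subseteq> U" "S \<noteq> {}"
    define D where "D y = (INF s\<in>S. d y s)" for y
    have bdd: "bdd_below (d y ` S)" for y
      by (rule bdd_belowI[of _ 0]) auto
    have D0: "D y \<ge> 0" for y
      unfolding D_def using S by (intro cINF_greatest) auto
    have DS: "D y = 0" if "y \<in> S" for y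
    proof -
      have "D y \<le> d y y"
        unfolding D_def by (rule cINF_lower[OF bdd that])
      then show ?thesis
        using D0[of y] that S by auto
    qed
    have Dless: "\<exists>s\<in>S. d y s < \<eta>" if "D y < \<eta>" for y
      using that cINF_less_iff[OF S(2) bdd] unfolding D_def by blast
    have Dlip: "D y \<le> D y' + d y y'" if "y \<in> U" "y' \<in> U" for y y'
    proof -
      have "D y - d y y' \<le> D y'"
        unfolding D_def[of y']
      proof (rule cINF_greatest[OF S(2)])
        fix s assume s: "s \<in> S"
        have "D y \<le> d y s"
          unfolding D_def by (rule cINF_lower[OF bdd s])
        also have "\<dots> \<le> d y y' + d y' s"
          using that s S by (intro triangle) auto
        finally show "D y - d y y' \<le> d y' s" by simp
      qed
      then show ?thesis by simp
    qed
    \<comment> \<open>As \<open>C\<close> bounds all distances between orbit points of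
      \<open>B\<close>, the upper Katetov inequality holds for every \<open>S\<close>. Truncation at
      \<open>\<eta>\<close> keeps the realised distances bounded independently of
      \<open>S\<close>.\<close>
    obtain z where z: "z \<in> U" "\<And>g b. g \<in> G \<Longrightarrow> b \<in> B \<Longrightarrow> d z (g b) = C + min \<eta> (D (g b))"
    proof (rule orbit_extension[OF B(1,2), where \<phi> = "\<lambda>y. C + min \<eta> (D y)"])
      show "C + min \<eta> (D y) > 0" for y
        using C(1) \<eta> D0[of y] by simp
      show "C + min \<eta> (D y) \<le> C + min \<eta> (D y') + d y y'" if "y \<in> U" "y' \<in> U" for y y'
        using Dlip[OF that] nonneg[of y y'] by linarith
      show "d (g b) (h c) \<le> C + min \<eta> (D (g b)) + (C + min \<eta> (D (h c)))"
        if "g \<in> G" "h \<in> G" "b \<in> B" "c \<in> B" for g h b c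
        using C(2)[OF that] C(1) \<eta> D0[of "g b"] D0[of "h c"] by (auto simp: min_def)
    qed blast
    show "\<exists>z\<in>U. \<forall>g\<in>G. \<forall>b\<in>B.
      d z (g b) \<le> C + \<eta> \<and> (g b \<in> S \<longrightarrow> d z (g b) = C) \<and>
      (d z (g b) < C + \<eta> \<longrightarrow> (\<exists>s\<in>S. d (g b) s < \<eta>))"
      using z DS Dless \<eta> by (intro bexI[of _ z]) (auto simp: min_def split: if_splits)
  qed
qed

section \<open>Left uniform continuity tested at a single point\<close>

text \<open>The offset \<open>d x1 x2 / 2\<close> prevents an isometry that almost fixes the new point from
  exchanging \<open>x1\<close> and \<open>x2\<close>.\<close>
lemma two_points_controlled_by_one:
  assumes x: "x1 \<in> U" "x2 \<in> U" and \<delta>: "\<delta> > 0"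
  obtains x \<eta> where "x \<in> U" "\<eta> > 0"
    "\<And>g. \<lbrakk>g \<in> G; d (g x) x < \<eta>\<rbrakk> \<Longrightarrow> d (g x1) x1 < \<delta> \<and> d (g x2) x2 < \<delta>"
proof (cases "x1 = x2")
  case True
  then show thesis
    using that[of x1 \<delta>] x \<delta> by auto
next
  case False
  define s where "s = d x1 x2"
  have s: "s > 0"
    using False x by (simp add: s_def)
  obtain C where C: "C > 0"
    "\<And>g h b c. \<lbrakk>g \<in> G; h \<in> G; b \<in> {x1, x2}; c \<in> {x1, x2}\<rbrakk> \<Longrightarrow> d (g b) (h c) \<le> C"
    by (rule orbits_bounded[OF x(1), of "{x1, x2}" s]) (use x s in \<open>auto simp: s_def commute\<close>)
  define \<phi> where "\<phi> y = min (C + d y x1) (C + s / 2 + d y x2)" for y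
  obtain x where xU: "x \<in> U" and x\<phi>: "\<And>g b. g \<in> G \<Longrightarrow> b \<in> {x1, x2} \<Longrightarrow> d x (g b) = \<phi> (g b)"
  proof (rule orbit_extension[of "{x1, x2}" \<phi>])
    have ge: "\<phi> y \<ge> C" for y
      using s nonneg[of y x1] nonneg[of y x2] unfolding \<phi>_def by (simp add: min_def del: nonneg)
    show "\<phi> y > 0" for y
      using ge[of y] C(1) by simp
    show "\<phi> y \<le> \<phi> y' + d y y'" if "y \<in> U" "y' \<in> U" for y y'
      using triangle[OF that x(1)] triangle[OF that x(2)] unfolding \<phi>_def by (simp add: min_def)
    show "d (g b) (h c) \<le> \<phi> (g b) + \<phi> (h c)"
      if "g \<in> G" "h \<in> G" "b \<in> {x1, x2}" "c \<in> {x1, x2}" for g h b c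
      using C(2)[OF that] ge[of "g b"] ge[of "h c"] C(1) by linarith
  qed (use x in auto)
  have \<phi>x: "\<phi> x1 = C" "\<phi> x2 = C + s / 2"
    using s x by (auto simp: \<phi>_def s_def commute)
  show thesis
  proof
    show "x \<in> U" by fact
    show "min \<delta> (s / 4) > 0"
      using \<delta> s by simp
    fix g assume g: "g \<in> G" and less: "d (g x) x < min \<delta> (s / 4)"
    \<comment> \<open>Both values are distances to \<open>g b\<close>, one from \<open>x\<close> and
      the other from \<open>g x\<close>, hence differ by at most \<open>d (g x) x\<close>.\<close>
    have close: "\<bar>\<phi> (g b) - \<phi> b\<bar> < min \<delta> (s / 4)" if "b \<in> {x1, x2}" for b
    proof -
      have b: "b \<in> U"
        using that x by blast
      have "d x b = \<phi> b"
        using x\<phi>[OF one_in_G that] b by simp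
      then have "d (g x) (g b) = \<phi> b"
        using g b xU by simp
      moreover have "d x (g b) = \<phi> (g b)"
        by (rule x\<phi>[OF g that])
      moreover have "\<bar>d x (g b) - d (g x) (g b)\<bar> \<le> d (g x) x"
        using triangle[of x "g x" "g b"] triangle[of "g x" x "g b"] g b xU commute[of x "g x"]
        by simp
      ultimately show ?thesis
        using less by linarith
    qed
    \<comment> \<open>The second branch of \<open>\<phi> (g x1)\<close> is at least
      \<open>C + s / 2\<close>, too large to be within \<open>s / 4\<close> of \<open>C\<close>; so
      the first branch is the minimum.\<close>
    have 1: "d (g x1) x1 < min \<delta> (s / 4)"
      using close[OF insertI1] s nonneg[of "g x1" x2] unfolding \<phi>x unfolding \<phi>_def
      by linarith
    \<comment> \<open>Since \<open>g x1\<close> stays near \<open>x1\<close>, the point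
      \<open>g x2\<close> is more than \<open>3 * s / 4\<close> away from \<open>x1\<close>. This
      rules out the first branch at \<open>g x2\<close>.\<close>
    have "s \<le> d (g x2) x1 + d (g x1) x1"
      using triangle[of "g x2" x1 "g x1"] g x by (simp add: s_def commute)
    then have "d (g x2) x2 < min \<delta> (s / 4)"
      using close[of x2, OF insertI2[OF singletonI]] s 1 unfolding \<phi>x unfolding \<phi>_def
      by linarith
    with 1 show "d (g x1) x1 < \<delta> \<and> d (g x2) x2 < \<delta>"
      by simp
  qed
qed

text \<open>Points are merged two at a time.\<close>

lemma finitely_many_points_controlled_by_one:
  assumes "finite F" "F \<subseteq> U" "\<delta> > 0"
  shows "\<exists>x\<in>U. \<exists>\<eta>>0. \<forall>g\<in>G. d (g x) x < \<eta> \<longrightarrow> (\<forall>y\<in>F. d (g y) y < \<delta>)"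
  using assms(1,2)
proof (induction F rule: finite_induct)
  case empty
  \<comment> \<open>Extending the empty set by one point shows that \<open>U\<close> is
    nonempty.\<close>
  have "|{} :: 'a set| <o |M|"
    using countable_ordLess_uncountable uncountable by blast
  then obtain z where "z \<in> U"
    using one_point_extension[of "{}"] by blast
  with zero_less_one show ?case by blast
next
  case (insert y F)
  then obtain x \<eta> where x: "x \<in> U" "\<eta> > 0" "\<And>g. g \<in> G \<Longrightarrow> d (g x) x < \<eta> \<Longrightarrow> \<forall>y\<in>F. d (g y) y < \<delta>"
    by auto
  have y: "y \<in> U"
    using insert.prems by simp
  \<comment> \<open>The tolerance \<open>min \<delta> \<eta>\<close> controls \<open>y\<close> up to
    \<open>\<delta>\<close> and the earlier point \<open>x\<close> up to its own
    \<open>\<eta>\<close>.\<close>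
  obtain x' \<eta>' where "x' \<in> U" "\<eta>' > 0"
    "\<And>g. \<lbrakk>g \<in> G; d (g x') x' < \<eta>'\<rbrakk> \<Longrightarrow> d (g x) x < min \<delta> \<eta> \<and> d (g y) y < min \<delta> \<eta>"
    using two_points_controlled_by_one[OF x(1) y, of "min \<delta> \<eta>"] x(2) assms(3) by auto
  then show ?case
    using x(3) by (metis insert_iff min_less_iff_conj)
qed

text \<open>The distance between \<open>g x\<close> and \<open>h x\<close> is the displacement of
  \<open>x\<close> under the quotient of \<open>g\<close> and \<open>h\<close> used by the left
  uniformity, and one-point displacement sets form a neighbourhood base at the identity.\<close>

lemma left_unif_cont_iff:
  "left_unif_cont U d G f \<longleftrightarrow>
    (\<forall>\<epsilon>>0. \<exists>x\<in>U. \<exists>\<eta>>0. \<forall>g\<in>G. \<forall>h\<in>G. d (g x) (h x) < \<eta> \<longrightarrow> \<bar>f g - f h\<bar> < \<epsilon>)"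
proof -
  have eq: "d (iso_mult U (iso_inv U g) h x) x = d (g x) (h x)" if "g \<in> G" "h \<in> G" "x \<in> U" for g h x
    using that by (simp add: dist_inv_left commute[of "h x"])
  show ?thesis
    unfolding left_unif_cont_def
  proof (intro all_cong iffI)
    fix \<epsilon> :: real
    assume "\<exists>V. openin (G_topology U d G) V \<and> iso_one U \<in> V \<and>
        (\<forall>g\<in>G. \<forall>h\<in>G. iso_mult U (iso_inv U g) h \<in> V \<longrightarrow> \<bar>f g - f h\<bar> < \<epsilon>)"
    then obtain V where V: "openin (G_topology U d G) V" "iso_one U \<in> V"
      "\<And>g h. \<lbrakk>g \<in> G; h \<in> G; iso_mult U (iso_inv U g) h \<in> V\<rbrakk> \<Longrightarrow> \<bar>f g - f h\<bar> < \<epsilon>"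
      by blast
    obtain F \<delta> where F: "finite F" "F \<subseteq> U" "\<delta> > 0"
      "\<And>g. g \<in> G \<Longrightarrow> (\<And>x. x \<in> F \<Longrightarrow> d (g x) x < \<delta>) \<Longrightarrow> g \<in> V"
      using nhd_one_contains_displacement[OF V(1,2)] by blast
    obtain x \<eta> where x: "x \<in> U" "\<eta> > 0" "\<And>g. g \<in> G \<Longrightarrow> d (g x) x < \<eta> \<Longrightarrow> \<forall>y\<in>F. d (g y) y < \<delta>"
      using finitely_many_points_controlled_by_one[OF F(1-3)] by blast
    have "\<bar>f g - f h\<bar> < \<epsilon>" if "g \<in> G" "h \<in> G" "d (g x) (h x) < \<eta>" for g h
    proof -
      have "d (iso_mult U (iso_inv U g) h x) x < \<eta>"
        using that x(1) eq by simp
      then have "iso_mult U (iso_inv U g) h \<in> V"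
        using that(1,2) F(4) x(3) by (meson inv_in_G mult_in_G)
      then show ?thesis
        using V(3) that by blast
    qed
    then show "\<exists>x\<in>U. \<exists>\<eta>>0. \<forall>g\<in>G. \<forall>h\<in>G. d (g x) (h x) < \<eta> \<longrightarrow> \<bar>f g - f h\<bar> < \<epsilon>"
      using x(1,2) by blast
  next
    fix \<epsilon> :: real
    assume "\<exists>x\<in>U. \<exists>\<eta>>0. \<forall>g\<in>G. \<forall>h\<in>G. d (g x) (h x) < \<eta> \<longrightarrow> \<bar>f g - f h\<bar> < \<epsilon>"
    then obtain x \<eta> where x: "x \<in> U" "\<eta> > 0"
      "\<And>g h. \<lbrakk>g \<in> G; h \<in> G; d (g x) (h x) < \<eta>\<rbrakk> \<Longrightarrow> \<bar>f g - f h\<bar> < \<epsilon>"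
      by blast
    show "\<exists>V. openin (G_topology U d G) V \<and> iso_one U \<in> V \<and>
        (\<forall>g\<in>G. \<forall>h\<in>G. iso_mult U (iso_inv U g) h \<in> V \<longrightarrow> \<bar>f g - f h\<bar> < \<epsilon>)"
      using openin_displacement[OF x(1), of \<eta>] x
      by (intro exI[of _ "{g \<in> G. d (g x) x < \<eta>}"]) (simp add: eq del: mult_apply)
  qed
qed

section \<open>Left translations near the identity\<close>

text \<open>Infinite descent: a translation by \<open>v\<close> that raises \<open>f\<close> somewhere would lower it
  without end along the iterates of \<open>v\<^sup>-\<^sup>1\<close>.\<close>
lemma no_rise_by_descent:
  fixes \<epsilon> :: real
  assumes "\<epsilon> > 0" and v: "v \<in> G"
    and nonneg: "\<And>g. g \<in> G \<Longrightarrow> 0 \<le> f g"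
    and step: "\<And>g. g \<in> G \<Longrightarrow> f g + \<epsilon> < f (iso_mult U v g) \<Longrightarrow>
      f (iso_mult U (iso_inv U v) g) + \<epsilon> < f g"
    and g: "g \<in> G"
  shows "f (iso_mult U v g) \<le> f g + \<epsilon>"
proof (rule ccontr)
  assume rise: "\<not> ?thesis"
  have "\<forall>g\<in>G. f g + \<epsilon> < f (iso_mult U v g) \<longrightarrow> real j * \<epsilon> \<le> f g" for j
  proof (induction j)
    case 0
    show ?case
      using nonneg by simp
  next
    case (Suc j)
    show ?case
    proof (intro ballI impI)
      fix g assume g: "g \<in> G" "f g + \<epsilon> < f (iso_mult U v g)"
      define g' where "g' = iso_mult U (iso_inv U v) g"
      have g': "g' \<in> G" "iso_mult U v g' = g"
        using g(1) v unfolding g'_def by (auto intro!: G_eqI)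
      \<comment> \<open>This drop is again a rise, now at \<open>g'\<close>, because
        \<open>v\<close> maps \<open>g'\<close> to \<open>g\<close>; the induction hypothesis
        therefore applies to \<open>g'\<close>.\<close>
      have "f g' + \<epsilon> < f g"
        using step[OF g] by (simp add: g'_def)
      moreover from this have "real j * \<epsilon> \<le> f g'"
        using Suc.IH g' by simp
      ultimately show "real (Suc j) * \<epsilon> \<le> f g"
        by (simp add: algebra_simps)
    qed
  qed
  then have "real j * \<epsilon> \<le> f g" for j
    using g rise by simp
  moreover obtain j where "f g < real j * \<epsilon>"
    using reals_Archimedean3[OF \<open>\<epsilon> > 0\<close>] by blast
  ultimately show False
    by (meson not_le)
qed

text \<open>The points \<open>z n\<close> encode the sublevel sets \<open>A n\<close> of \<open>f\<close> by their distances to the orbit of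
  \<open>x\<close>, and the points \<open>w i\<close> encode the sets \<open>{z n | n mod 5 = i}\<close>. An isometry almost fixing
  every \<open>w i\<close> maps the chain of the \<open>A n\<close> to itself up to one index, preserving \<open>n mod 5\<close>;
  the classes modulo 5 make a change of index larger than the error.\<close>
lemma uniformly_small_left_translation:
  fixes \<epsilon> :: real
  assumes x: "x \<in> U" and \<eta>: "\<eta> > 0" and \<epsilon>: "\<epsilon> > 0"
    and f0: "\<And>g. g \<in> G \<Longrightarrow> 0 \<le> f g" and f1: "f (iso_one U) = 0"
    and uc: "\<And>g h. \<lbrakk>g \<in> G; h \<in> G; d (g x) (h x) < \<eta>\<rbrakk> \<Longrightarrow> \<bar>f g - f h\<bar> < \<epsilon>"
  shows "\<exists>V. openin (G_topology U d G) V \<and> iso_one U \<in> V \<and>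
    (\<forall>v\<in>V. \<forall>g\<in>G. \<bar>f (iso_mult U v g) - f g\<bar> \<le> 2 * \<epsilon>)"
proof -
  define A where "A n = {g \<in> G. f g \<le> real n * \<epsilon>}" for n
  have one_A: "iso_one U \<in> A n" for n
    using f1 \<epsilon> by (simp add: A_def)
  \<comment> \<open>One constant is fixed before the sublevel sets enter, so all \<open>z n\<close>
    share the two levels \<open>C\<close> and \<open>C + \<eta>\<close>.\<close>
  obtain C where C: "\<And>S. S \<subseteq> U \<Longrightarrow> S \<noteq> {} \<Longrightarrow> \<exists>z\<in>U. \<forall>g\<in>G. \<forall>b\<in>{x}.
    d z (g b) \<le> C + \<eta> \<and> (g b \<in> S \<longrightarrow> d z (g b) = C) \<and>
    (d z (g b) < C + \<eta> \<longrightarrow> (\<exists>s\<in>S. d (g b) s < \<eta>))"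
    by (rule realise_distance_to_set[OF x, of "{x}" 0 \<eta>]) (use x \<eta> in auto)
  have "\<exists>z\<in>U. \<forall>g\<in>G. d z (g x) \<le> C + \<eta> \<and> (g \<in> A n \<longrightarrow> d z (g x) = C) \<and>
    (d z (g x) < C + \<eta> \<longrightarrow> g \<in> A (Suc n))" for n
  proof -
    have "(\<lambda>h. h x) ` A n \<subseteq> U"
      using x by (auto simp: A_def)
    moreover have "(\<lambda>h. h x) ` A n \<noteq> {}"
      using one_A[of n] by blast
    ultimately obtain z where z: "z \<in> U" "\<And>g. g \<in> G \<Longrightarrow> d z (g x) \<le> C + \<eta>"
      "\<And>g. g \<in> G \<Longrightarrow> g x \<in> (\<lambda>h. h x) ` A n \<Longrightarrow> d z (g x) = C"
      "\<And>g. g \<in> G \<Longrightarrow> d z (g x) < C + \<eta> \<Longrightarrow> \<exists>h\<in>A n. d (g x) (h x) < \<eta>"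
      using C[of "(\<lambda>h. h x) ` A n"] by auto
    \<comment> \<open>Coming within \<open>\<eta>\<close> of the orbit points of \<open>A n\<close>
      raises \<open>f\<close> by less than \<open>\<epsilon>\<close>, which is one index.\<close>
    have "g \<in> A (Suc n)" if "g \<in> G" "d z (g x) < C + \<eta>" for g
    proof -
      obtain h where "h \<in> A n" "d (g x) (h x) < \<eta>"
        using z(4) \<open>g \<in> G\<close> \<open>d z (g x) < C + \<eta>\<close> by blast
      then show ?thesis
        using uc[OF \<open>g \<in> G\<close>, of h] \<open>g \<in> G\<close> by (auto simp: A_def algebra_simps)
    qed
    then show ?thesis
      using z by blast
  qed
  then obtain z where zU: "\<And>n. z n \<in> U" and z_le: "\<And>n g. g \<in> G \<Longrightarrow> d (z n) (g x) \<le> C + \<eta>"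
    and z_eq: "\<And>n g. g \<in> G \<Longrightarrow> g \<in> A n \<Longrightarrow> d (z n) (g x) = C"
    and z_less: "\<And>n g. g \<in> G \<Longrightarrow> d (z n) (g x) < C + \<eta> \<Longrightarrow> g \<in> A (Suc n)"
    by metis
  define Z where "Z i = z ` {n. n mod 5 = i}" for i :: nat
  have "\<exists>w\<in>U. \<forall>g\<in>G. \<forall>b\<in>Z i. d w (g b) < d w b + \<eta> \<longrightarrow> (\<exists>c\<in>Z i. d (g b) c < \<eta>)"
    if "i < 5" for i
  proof -
    have "i mod 5 = i"
      using that by simp
    \<comment> \<open>The bound \<open>C + \<eta>\<close> is uniform in \<open>n\<close>, so the
      infinite set \<open>Z i\<close> can serve as a set of base points; it is nonempty since it
      contains \<open>z i\<close>.\<close>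
    then have Zi: "Z i \<subseteq> U" "countable (Z i)" "Z i \<noteq> {}" "\<And>b. b \<in> Z i \<Longrightarrow> d b x \<le> C + \<eta>"
      using zU z_le[OF one_in_G] x by (auto simp: Z_def)
    obtain K where K: "\<And>S. S \<subseteq> U \<Longrightarrow> S \<noteq> {} \<Longrightarrow> \<exists>w\<in>U. \<forall>g\<in>G. \<forall>b\<in>Z i.
      d w (g b) \<le> K + \<eta> \<and> (g b \<in> S \<longrightarrow> d w (g b) = K) \<and>
      (d w (g b) < K + \<eta> \<longrightarrow> (\<exists>s\<in>S. d (g b) s < \<eta>))"
      by (rule realise_distance_to_set[OF x Zi(1,2,4) \<eta>]) blast+
    from K[OF Zi(1,3)] obtain w where w: "w \<in> U" "\<forall>g\<in>G. \<forall>b\<in>Z i. d w (g b) \<le> K + \<eta> \<and>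
      (g b \<in> Z i \<longrightarrow> d w (g b) = K) \<and> (d w (g b) < K + \<eta> \<longrightarrow> (\<exists>c\<in>Z i. d (g b) c < \<eta>))"
      by (rule bexE)
    \<comment> \<open>With \<open>S\<close> chosen as \<open>Z i\<close> itself, all of
      \<open>Z i\<close> lies at the lowest level \<open>K\<close>.\<close>
    have "d w b = K" if "b \<in> Z i" for b
      using w(2)[rule_format, OF one_in_G that] that Zi(1) by (simp add: subset_iff)
    with w show ?thesis
      by (intro bexI[OF _ w(1)]) simp
  qed
  then obtain w where wU: "\<And>i. i < 5 \<Longrightarrow> w i \<in> U"
    and w_less: "\<And>i g b. \<lbrakk>i < 5; g \<in> G; b \<in> Z i; d (w i) (g b) < d (w i) b + \<eta>\<rbrakk>
      \<Longrightarrow> \<exists>c\<in>Z i. d (g b) c < \<eta>"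
    by metis
  define V where "V = {g \<in> G. \<forall>i<5. d (g (w i)) (w i) < \<eta>}"
  have "V = (\<Inter>i\<in>{..<5}. {g \<in> G. d (g (w i)) (w i) < \<eta>})"
    by (auto simp: V_def intro: zero_less_numeral)
  moreover have "openin (G_topology U d G) \<dots>"
    using wU by (intro openin_INT2 openin_displacement) (auto simp: lessThan_empty_iff)
  ultimately have V: "openin (G_topology U d G) V"
    by simp
  have V1: "iso_one U \<in> V"
    using wU \<eta> by (simp add: V_def)
  have VG: "v \<in> G" if "v \<in> V" for v
    using that by (simp add: V_def)
  have V_inv: "iso_inv U v \<in> V" if "v \<in> V" for v
  proof -
    have "d (iso_inv U v (w i)) (w i) = d (v (w i)) (w i)" if "i < 5" for i
      using dist_inv_left[OF VG[OF \<open>v \<in> V\<close>] wU[OF that] wU[OF that]] commute[of "w i" "v (w i)"]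
      by simp
    then show ?thesis
      using that by (simp add: V_def)
  qed
  \<comment> \<open>The inverse of \<open>v\<close> almost fixes \<open>w i\<close>, so it moves
    \<open>z r\<close> to within \<open>\<eta>\<close> of some \<open>z t\<close> of the same class.
    Orbit points at distance \<open>C\<close> from one of \<open>z r\<close>, \<open>z t\<close> are
    thus moved to distance below \<open>C + \<eta>\<close> from the other, which costs one
    index.\<close>
  have shift: "\<exists>t. t mod 5 = r mod 5 \<and>
      (\<forall>g\<in>A t. iso_mult U v g \<in> A (Suc r)) \<and> (\<forall>g\<in>A r. iso_mult U (iso_inv U v) g \<in> A (Suc t))"
    if v: "v \<in> V" for v r
  proof -
    have vG: "v \<in> G"
      using VG v by blast
    define i where "i = r mod 5"
    have i: "i < 5" "z r \<in> Z i"
      by (auto simp: i_def Z_def)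
    have "d (w i) (iso_inv U v (z r)) = d (v (w i)) (z r)"
      using dist_inv_left[OF vG zU wU[OF i(1)], of r]
      by (simp add: commute[of "w i" "iso_inv U v (z r)"] commute[of "v (w i)" "z r"])
    also have "\<dots> \<le> d (v (w i)) (w i) + d (w i) (z r)"
      using vG wU[OF i(1)] zU by (intro triangle) auto
    also have "\<dots> < d (w i) (z r) + \<eta>"
      using v i(1) by (simp add: V_def)
    finally obtain t where t: "t mod 5 = i" "d (iso_inv U v (z r)) (z t) < \<eta>"
      using w_less[OF i(1) inv_in_G[OF vG] i(2)] by (auto simp: Z_def)
    have "iso_mult U v g \<in> A (Suc r)" if "g \<in> A t" for g
    proof -
      have g: "g \<in> G"
        using that by (simp add: A_def)
      have "d (z r) (iso_mult U v g x) = d (iso_inv U v (z r)) (g x)"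
        using vG g x zU by (simp add: dist_inv_left)
      also have "\<dots> \<le> d (iso_inv U v (z r)) (z t) + d (z t) (g x)"
        using vG g x zU by (intro triangle) auto
      also have "\<dots> < C + \<eta>"
        using t(2) z_eq[OF g that] by simp
      finally show ?thesis
        using z_less vG g by simp
    qed
    moreover have "iso_mult U (iso_inv U v) g \<in> A (Suc t)" if "g \<in> A r" for g
    proof -
      have g: "g \<in> G"
        using that by (simp add: A_def)
      have "d (z t) (iso_mult U (iso_inv U v) g x)
        \<le> d (z t) (iso_inv U v (z r)) + d (iso_inv U v (z r)) (iso_mult U (iso_inv U v) g x)"
        using vG g x zU by (intro triangle) auto
      also have "d (iso_inv U v (z r)) (iso_mult U (iso_inv U v) g x) = C"
        using z_eq[OF g that] vG g x zU by simp
      finally have "d (z t) (iso_mult U (iso_inv U v) g x) < C + \<eta>"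
        using t(2) commute[of "z t" "iso_inv U v (z r)"] by simp
      then show ?thesis
        using z_less vG g by simp
    qed
    ultimately show ?thesis
      using t(1) by (auto simp: i_def)
  qed
  have step: "f (iso_mult U (iso_inv U v) g) + 2 * \<epsilon> < f g"
    if v: "v \<in> V" and g: "g \<in> G" and rise: "f g + 2 * \<epsilon> < f (iso_mult U v g)" for v g
  proof -
    \<comment> \<open>The least index with \<open>g\<close> in \<open>A r\<close>; the rise by more
      than \<open>2 * \<epsilon>\<close> carries the translate beyond
      \<open>A (Suc r)\<close>.\<close>
    define r where "r = nat \<lceil>f g / \<epsilon>\<rceil>"
    have "0 \<le> f g / \<epsilon>"
      using f0[OF g] \<epsilon> by simp
    then have "f g / \<epsilon> \<le> real r" "real r < f g / \<epsilon> + 1"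
      unfolding r_def by linarith+
    then have r: "f g \<le> real r * \<epsilon>" "real r * \<epsilon> < f g + \<epsilon>"
      using \<epsilon> by (auto simp: field_simps)
    obtain t where t: "t mod 5 = r mod 5" "\<And>h. h \<in> A t \<Longrightarrow> iso_mult U v h \<in> A (Suc r)"
      "\<And>h. h \<in> A r \<Longrightarrow> iso_mult U (iso_inv U v) h \<in> A (Suc t)"
      using shift[OF v, of r] by blast
    have "iso_mult U v g \<notin> A (Suc r)"
      using rise r(2) by (simp add: A_def algebra_simps)
    then have "g \<notin> A t"
      using t(2) by blast
    then have "real t * \<epsilon> < real r * \<epsilon>"
      using g r(1) by (simp add: A_def)
    then have "t < r"
      using \<epsilon> by simp
    moreover have "5 dvd r - t"
      using t(1) \<open>t < r\<close> mod_eq_dvd_iff_nat[of t r 5] by simp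
    \<comment> \<open>Congruence turns \<open>t < r\<close> into a gap of at least 5. The value at
      the inverse translate is then at most \<open>(r - 4) * \<epsilon>\<close>, which is below
      \<open>f g - 3 * \<epsilon>\<close>.\<close>
    ultimately have "Suc t + 4 \<le> r"
      using dvd_imp_le[of 5 "r - t"] by simp
    then have "(real (Suc t) + 4) * \<epsilon> \<le> real r * \<epsilon>"
      using \<epsilon> by (intro mult_right_mono) linarith+
    moreover have "f (iso_mult U (iso_inv U v) g) \<le> real (Suc t) * \<epsilon>"
      using t(3)[of g] g r(1) by (simp add: A_def)
    ultimately show ?thesis
      using r(2) \<epsilon> by (simp add: algebra_simps)
  qed
  have bound: "f (iso_mult U v g) \<le> f g + 2 * \<epsilon>" if "v \<in> V" "g \<in> G" for v g
    by (rule no_rise_by_descent) (use \<epsilon> VG[OF that(1)] f0 step[OF that(1)] that in auto)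
  show ?thesis
  proof (intro exI conjI ballI)
    fix v g assume v: "v \<in> V" and g: "g \<in> G"
    \<comment> \<open>\<open>V\<close> is closed under inversion, so the upper bound for the inverse
      of \<open>v\<close> at the translate of \<open>g\<close> yields the lower bound.\<close>
    have "iso_mult U (iso_inv U v) (iso_mult U v g) = g"
      using VG[OF v] g by (auto intro!: G_eqI)
    then show "\<bar>f (iso_mult U v g) - f g\<bar> \<le> 2 * \<epsilon>"
      using bound[OF v g] bound[OF V_inv[OF v], of "iso_mult U v g"] VG[OF v] g by simp
  qed (fact V V1)+
qed

section \<open>Comparison of the two uniformities\<close>

text \<open>The positive and negative parts of \<open>f - f (iso_one U)\<close> are nonnegative and
  vanish at the identity, so small left translations change each of them uniformly little.\<close>

lemma left_unif_cont_imp_right: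
  assumes "left_unif_cont U d G f"
  shows "right_unif_cont U d G f"
  unfolding right_unif_cont_def
proof (intro allI impI)
  fix \<epsilon> :: real assume "\<epsilon> > 0"
  \<comment> \<open>Each of the two parts will change by at most
    \<open>2 * (\<epsilon> / 5)\<close>, which leaves a total strictly below
    \<open>\<epsilon>\<close>.\<close>
  then have \<epsilon>5: "\<epsilon> / 5 > 0"
    by simp
  from assms[unfolded left_unif_cont_iff, rule_format, OF this]
  obtain x \<eta> where x: "x \<in> U" "\<eta> > 0"
    and uc: "\<And>g h. \<lbrakk>g \<in> G; h \<in> G; d (g x) (h x) < \<eta>\<rbrakk> \<Longrightarrow> \<bar>f g - f h\<bar> < \<epsilon> / 5"
    by (elim bexE exE conjE) simp
  define f1 where "f1 g = max (f g - f (iso_one U)) 0" for g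
  define f2 where "f2 g = max (f (iso_one U) - f g) 0" for g
  have f12: "f g - f h = (f1 g - f1 h) - (f2 g - f2 h)" for g h
    by (simp add: f1_def f2_def max_def)
  have uc12: "\<bar>f1 g - f1 h\<bar> < \<epsilon> / 5" "\<bar>f2 g - f2 h\<bar> < \<epsilon> / 5"
    if "g \<in> G" "h \<in> G" "d (g x) (h x) < \<eta>" for g h
    using uc[OF that] \<open>\<epsilon> > 0\<close> unfolding f1_def f2_def by linarith+
  have f12_0: "0 \<le> f1 g" "0 \<le> f2 g" "f1 (iso_one U) = 0" "f2 (iso_one U) = 0" for g
    by (simp_all add: f1_def f2_def)
  have small: "\<exists>V. openin (G_topology U d G) V \<and> iso_one U \<in> V \<and>
      (\<forall>v\<in>V. \<forall>g\<in>G. \<bar>k (iso_mult U v g) - k g\<bar> \<le> 2 * (\<epsilon> / 5))" if "k = f1 \<or> k = f2" for k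
    by (rule uniformly_small_left_translation[OF x \<epsilon>5]) (use that f12_0 uc12 in auto)
  obtain V1 where V1: "openin (G_topology U d G) V1" "iso_one U \<in> V1"
      "\<And>v g. \<lbrakk>v \<in> V1; g \<in> G\<rbrakk> \<Longrightarrow> \<bar>f1 (iso_mult U v g) - f1 g\<bar> \<le> 2 * (\<epsilon> / 5)"
    using small[of f1] by blast
  obtain V2 where V2: "openin (G_topology U d G) V2" "iso_one U \<in> V2"
      "\<And>v g. \<lbrakk>v \<in> V2; g \<in> G\<rbrakk> \<Longrightarrow> \<bar>f2 (iso_mult U v g) - f2 g\<bar> \<le> 2 * (\<epsilon> / 5)"
    using small[of f2] by blast
  have "\<bar>f g - f h\<bar> < \<epsilon>"
    if g: "g \<in> G" and h: "h \<in> G" and V: "iso_mult U g (iso_inv U h) \<in> V1 \<inter> V2" for g h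
  proof -
    \<comment> \<open>This exhibits \<open>g\<close> as a left translate of \<open>h\<close> by an
      element of both neighbourhoods.\<close>
    have "iso_mult U (iso_mult U g (iso_inv U h)) h = g"
      using g h by (auto intro!: G_eqI)
    then have "\<bar>f1 g - f1 h\<bar> \<le> 2 * (\<epsilon> / 5)" "\<bar>f2 g - f2 h\<bar> \<le> 2 * (\<epsilon> / 5)"
      using V1(3)[OF _ h] V2(3)[OF _ h] V by fastforce+
    then show ?thesis
      using f12[of g h] \<open>\<epsilon> > 0\<close> by linarith
  qed
  then show "\<exists>V. openin (G_topology U d G) V \<and> iso_one U \<in> V \<and>
      (\<forall>g\<in>G. \<forall>h\<in>G. iso_mult U g (iso_inv U h) \<in> V \<longrightarrow> \<bar>f g - f h\<bar> < \<epsilon>)"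
    using V1 V2 by (intro exI[of _ "V1 \<inter> V2"]) auto
qed

lemma inv_inv: "g \<in> G \<Longrightarrow> iso_inv U (iso_inv U g) = g"
proof (rule G_eqI)
  fix x assume "g \<in> G" "x \<in> U"
  then show "iso_inv U (iso_inv U g) x = g x"
    using inv_apply(1)[of "iso_inv U g" "g x"] by simp
qed auto

lemma right_unif_cont_imp_left_inv:
  assumes "right_unif_cont U d G f"
  shows "left_unif_cont U d G (\<lambda>g. f (iso_inv U g))"
  unfolding left_unif_cont_def
proof (intro allI impI)
  fix \<epsilon> :: real assume "\<epsilon> > 0"
  from assms[unfolded right_unif_cont_def, rule_format, OF this]
  obtain V where V: "openin (G_topology U d G) V" "iso_one U \<in> V"
    "\<And>g h. \<lbrakk>g \<in> G; h \<in> G; iso_mult U g (iso_inv U h) \<in> V\<rbrakk> \<Longrightarrow> \<bar>f g - f h\<bar> < \<epsilon>"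
    by (elim exE conjE) simp
  have "\<bar>f (iso_inv U g) - f (iso_inv U h)\<bar> < \<epsilon>"
    if "g \<in> G" "h \<in> G" "iso_mult U (iso_inv U g) h \<in> V" for g h
    using V(3)[of "iso_inv U g" "iso_inv U h"] that by (simp add: inv_inv)
  then show "\<exists>V. openin (G_topology U d G) V \<and> iso_one U \<in> V \<and>
      (\<forall>g\<in>G. \<forall>h\<in>G. iso_mult U (iso_inv U g) h \<in> V \<longrightarrow> \<bar>f (iso_inv U g) - f (iso_inv U h)\<bar> < \<epsilon>)"
    using V(1,2) by blast
qed

text \<open>Inversion exchanges the two uniformities: composing with it, applying the implication
  from left to right, and composing again returns to \<open>f\<close>.\<close>

lemma right_unif_cont_imp_left:
  assumes "right_unif_cont U d G f"
  shows "left_unif_cont U d G f"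
proof -
  have "left_unif_cont U d G (\<lambda>g. f (iso_inv U (iso_inv U g)))"
    using assms right_unif_cont_imp_left_inv left_unif_cont_imp_right by blast
  then show ?thesis
    by (simp add: left_unif_cont_def inv_inv cong: ball_cong)
qed

end

theorem theorem4p6p2:
  fixes M :: "'k set" and U :: "'a set" and d :: "'a \<Rightarrow> 'a \<Rightarrow> real"
    and G :: "('a \<Rightarrow> 'a) set"
  assumes uncountable: "uncountable M"
    and sup_exp: "\<forall>N :: 'k set. (card_of N, card_of M) \<in> ordLess \<longrightarrow>
       (BNF_Cardinal_Arithmetic.cexp (card_of M) (card_of N), card_of M) \<in> ordLeq"
    and UK: "urysohn_katetov U d M"
    and subgroup: "iso_subgroup U d G"
    and dens: "density_less (G_topology U d G) M"
    and OB: "property_OB U d G"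
  shows "FSIN U d G"
proof -
  interpret Metric_space U d
    using UK unfolding urysohn_katetov_def by blast
  interpret urysohn_subgroup U d M G
    by unfold_locales (fact uncountable UK subgroup dens OB)+
  show ?thesis
    unfolding FSIN_def using left_unif_cont_imp_right right_unif_cont_imp_left by blast
qed

end
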